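(* Let $\Delta\subset\mathbb{R}^n$ be a lattice polytope and let $V(f)$ be a $\Delta$-hypersurface (with $f$ saturated) with dual complex $\mathcal{P}$. Let $\mathbf{x}_1,\dots,\mathbf{x}_K$ be points on $V(f)$ and $m_1,\dots,m_K$ positive integers such that $V(f)$ has multiplicity at least $m_i$ at $\mathbf{x}_i$ for each $i$. Assume that no two of the points lie in the relative interior of the same polyhedron of $V(f)$. Let $\mu$ be the weighting of $\mathcal{P}$ defined by $\mu(P)=m_i$ if $\mathbf{x}_i$ is in the relative interior of the polyhedron of $V(f)$ dual to $P$, and $\mu(P)=0$ if there is no such $i$. Then the following are equivalent: (1) $V(f)$ is the unique $\Delta$-hypersurface with multiplicity at least $m_i$ at $\mathbf{x}_i$ for each $i$. (2) $\mu$ is rigid.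
   Context: $\mathbb{T}$ is the min-plus semiring: the set $\mathbb{R}$ with $a\odot b=a+b$ and $a\oplus b=\min(a,b)$. For a lattice polytope $\Delta\subset\mathbb{R}^n$ put $\mathbb{Z}(\Delta)=\Delta\cap\mathbb{Z}^n$, and for a lattice polytope $P$ let $|P|$ be the number of lattice points in $P$. A tropical polynomial with support in $\Delta$ is a formal sum $f=\bigoplus_{I\in\mathbb{Z}(\Delta)}a_I\odot x_1^{\odot i_1}\odot\cdots\odot x_n^{\odot i_n}$ with $a_I\in\mathbb{T}$. For $\mathbf{y}\in\mathbb{T}^n$ let $B_f(\mathbf{y})\subset\mathbb{Z}(\Delta)$ be the set of $I$ achieving $\min_I\{a_I+\sum_k i_ky_k\}$. The tropical hypersurface ($\Delta$-hypersurface) $V(f)$ is the set of $\mathbf{y}$ with $|B_f(\mathbf{y})|\ge 2$, with its natural polyhedral structure. $f$ is saturated if every $I\in\mathbb{Z}(\Delta)$ lies in $B_f(\mathbf{y})$ for some $\mathbf{y}$; every $\Delta$-hypersurface is given by a saturated polynomial, and hypersurfaces $V(f)$ are always given with $f$ saturated. $V(f)$ has multiplicity $m$ at $p$ if $|B_f(p)|=m+1$. The dual complex of $V(f)$ is the polyhedral decomposition $\mathcal{P}$ of $\Delta$ whose cells are the convex hulls of the sets $B_f(\mathbf{y})$, $\mathbf{y}\in\mathbb{T}^n$. The relative interior of the polyhedron dual to a cell $P\in\mathcal{P}$ is the set of $\mathbf{y}$ such that the convex hull of $B_f(\mathbf{y})$ is $P$. A weighting of a lattice polyhedral decomposition $\mathcal{P}$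 of $\Delta$ (cells are nonempty lattice polytopes) is a map $\mu:\mathcal{P}\to\mathbb{Z}$ with $0\le\mu(P)\le|P|-1$ for all $P\in\mathcal{P}$. Let $\mathcal{P}^0$ be the set of vertices of $\mathcal{P}$. A nonempty subset $L\subset\mathbb{Z}(\Delta)$ that does not contain $\mathcal{P}^0$ is deformable (with respect to $\mu$) if for every $P\in\mathcal{P}$ either $|P\cap L|=0$ or $|P\cap L|\ge\mu(P)+1$. $\mu$ is rigid if no such $L$ is deformable. *)

theory Defs
  imports "HOL-Analysis.Analysis"
begin

definition lattice_points :: "(real ^ 'n) set \<Rightarrow> (real ^ 'n) set" where
  "lattice_points P = {v \<in> P. \<forall>k. v $ k \<in> \<int>}"

definition lattice_polytope :: "(real ^ 'n) set \<Rightarrow> bool" where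
  "lattice_polytope P \<longleftrightarrow>
     (\<exists>V. finite V \<and> V \<noteq> {} \<and> V = lattice_points V \<and> P = convex hull V)"

text \<open>
  A tropical polynomial with support in \<open>\<Delta>\<close> is represented by its coefficient function
  \<open>f\<close>, with \<open>f I\<close> the coefficient of the monomial with exponent \<open>I\<close>.  Only
  the values of \<open>f\<close> on \<open>lattice_points \<Delta>\<close> matter below.
  Since min-plus multiplication is real addition, the monomial with exponent \<open>I\<close> takes the value
  \<open>f I + I \<bullet> y\<close> at \<open>y\<close>.
\<close>

definition trop_eval :: "(real ^ 'n) set \<Rightarrow> (real ^ 'n \<Rightarrow> real) \<Rightarrow> real ^ 'n \<Rightarrow> real" where
  "trop_eval \<Delta> f y = Min ((\<lambda>I. f I + I \<bullet> y) ` lattice_points \<Delta>)"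

definition min_support ::
    "(real ^ 'n) set \<Rightarrow> (real ^ 'n \<Rightarrow> real) \<Rightarrow> real ^ 'n \<Rightarrow> (real ^ 'n) set" where
  "min_support \<Delta> f y = {I \<in> lattice_points \<Delta>. f I + I \<bullet> y = trop_eval \<Delta> f y}"

definition saturated :: "(real ^ 'n) set \<Rightarrow> (real ^ 'n \<Rightarrow> real) \<Rightarrow> bool" where
  "saturated \<Delta> f \<longleftrightarrow> (\<forall>I \<in> lattice_points \<Delta>. \<exists>y. I \<in> min_support \<Delta> f y)"

definition hypersurface :: "(real ^ 'n) set \<Rightarrow> (real ^ 'n \<Rightarrow> real) \<Rightarrow> (real ^ 'n) set" where
  "hypersurface \<Delta> f = {y. card (min_support \<Delta> f y) \<ge> 2}"

text \<open>The truncated subtraction is harmless, since \<open>min_support \<Delta> f p\<close> is nonempty.\<close>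

definition trop_mult :: "(real ^ 'n) set \<Rightarrow> (real ^ 'n \<Rightarrow> real) \<Rightarrow> real ^ 'n \<Rightarrow> nat" where
  "trop_mult \<Delta> f p = card (min_support \<Delta> f p) - 1"

definition dual_complex ::
    "(real ^ 'n) set \<Rightarrow> (real ^ 'n \<Rightarrow> real) \<Rightarrow> (real ^ 'n) set set" where
  "dual_complex \<Delta> f = range (\<lambda>y. convex hull (min_support \<Delta> f y))"

definition dual_rel_interior ::
    "(real ^ 'n) set \<Rightarrow> (real ^ 'n \<Rightarrow> real) \<Rightarrow> (real ^ 'n) set \<Rightarrow> (real ^ 'n) set" where
  "dual_rel_interior \<Delta> f P = {y. convex hull (min_support \<Delta> f y) = P}"

definition dual_polyhedron ::
    "(real ^ 'n) set \<Rightarrow> (real ^ 'n \<Rightarrow> real) \<Rightarrow> (real ^ 'n) set \<Rightarrow> (real ^ 'n) set" where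
  "dual_polyhedron \<Delta> f P = closure (dual_rel_interior \<Delta> f P)"

definition cell_vertices :: "(real ^ 'n) set set \<Rightarrow> (real ^ 'n) set" where
  "cell_vertices \<P> = {v. {v} \<in> \<P>}"

text \<open>
  The natural polyhedral structure on the hypersurface.  The polyhedra dual to the vertices of the
  dual complex are the full-dimensional closed regions of linearity, which are not part of the
  hypersurface.
\<close>

definition hypersurface_polyhedra ::
    "(real ^ 'n) set \<Rightarrow> (real ^ 'n \<Rightarrow> real) \<Rightarrow> (real ^ 'n) set set" where
  "hypersurface_polyhedra \<Delta> f =
     {dual_polyhedron \<Delta> f P | P. P \<in> dual_complex \<Delta> f \<and> (\<forall>v. P \<noteq> {v})}"

definition weighting :: "(real ^ 'n) set set \<Rightarrow> ((real ^ 'n) set \<Rightarrow> int) \<Rightarrow> bool" where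
  "weighting \<P> \<mu> \<longleftrightarrow>
     (\<forall>P \<in> \<P>. 0 \<le> \<mu> P \<and> \<mu> P \<le> int (card (lattice_points P)) - 1)"

definition deformable ::
    "(real ^ 'n) set \<Rightarrow> (real ^ 'n) set set \<Rightarrow> ((real ^ 'n) set \<Rightarrow> int) \<Rightarrow> (real ^ 'n) set \<Rightarrow> bool" where
  "deformable \<Delta> \<P> \<mu> L \<longleftrightarrow>
     L \<noteq> {} \<and> L \<subseteq> lattice_points \<Delta> \<and> \<not> cell_vertices \<P> \<subseteq> L \<and>
     (\<forall>P \<in> \<P>. card (P \<inter> L) = 0 \<or> int (card (P \<inter> L)) \<ge> \<mu> P + 1)"

definition rigid ::
    "(real ^ 'n) set \<Rightarrow> (real ^ 'n) set set \<Rightarrow> ((real ^ 'n) set \<Rightarrow> int) \<Rightarrow> bool" where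
  "rigid \<Delta> \<P> \<mu> \<longleftrightarrow> (\<nexists>L. deformable \<Delta> \<P> \<mu> L)"

text \<open>
  The index \<open>i\<close> below is unique when no two of the points lie in the same relative interior.
\<close>

definition point_weighting ::
    "(real ^ 'n) set \<Rightarrow> (real ^ 'n \<Rightarrow> real) \<Rightarrow> nat \<Rightarrow> (nat \<Rightarrow> real ^ 'n) \<Rightarrow> (nat \<Rightarrow> nat) \<Rightarrow>
     (real ^ 'n) set \<Rightarrow> int" where
  "point_weighting \<Delta> f K x m P =
     (if \<exists>i \<in> {1..K}. x i \<in> dual_rel_interior \<Delta> f P
      then int (m (THE i. i \<in> {1..K} \<and> x i \<in> dual_rel_interior \<Delta> f P))
      else 0)"

lemma finite_lattice_points:
  fixes P :: "(real ^ 'n) set"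
  assumes "bounded P"
  shows "finite (lattice_points P)"
proof -
  obtain b where b: "\<And>v. v \<in> P \<Longrightarrow> norm v \<le> b"
    using assms bounded_iff by blast
  let ?S = "real_of_int ` {-\<lceil>b\<rceil>..\<lceil>b\<rceil>}"
  have "lattice_points P \<subseteq> vec_lambda ` (Pi\<^sub>E UNIV (\<lambda>_. ?S))"
  proof
    fix v assume v: "v \<in> lattice_points P"
    have "v $ k \<in> ?S" for k
    proof -
      obtain z where z: "v $ k = real_of_int z"
        using v unfolding lattice_points_def by (auto elim: Ints_cases)
      have "\<bar>v $ k\<bar> \<le> b"
        using component_le_norm_cart[of v k] b[of v] v unfolding lattice_points_def by auto
      then have "z \<in> {-\<lceil>b\<rceil>..\<lceil>b\<rceil>}"
        unfolding z by (auto simp: abs_le_iff) linarith+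
      then show ?thesis using z by blast
    qed
    then have "($) v \<in> Pi\<^sub>E UNIV (\<lambda>_. ?S)" by auto
    moreover have "v = vec_lambda (($) v)" by (simp add: vec_nth_inverse)
    ultimately show "v \<in> vec_lambda ` (Pi\<^sub>E UNIV (\<lambda>_. ?S))" by blast
  qed
  moreover have "finite (Pi\<^sub>E (UNIV :: 'n set) (\<lambda>_. ?S))"
    by (rule finite_PiE) auto
  ultimately show ?thesis by (meson finite_imageI finite_subset)
qed

lemma weighting_point_weighting:
  fixes \<Delta> :: "(real ^ 'n) set"
  assumes "lattice_polytope \<Delta>"
    and mult: "\<And>i. i \<in> {1..K} \<Longrightarrow> trop_mult \<Delta> f (x i) \<ge> m i"
    and distinct: "\<And>i j P. \<lbrakk>i \<in> {1..K}; j \<in> {1..K}; i \<noteq> j; P \<in> dual_complex \<Delta> f\<rbrakk>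
      \<Longrightarrow> \<not> (x i \<in> dual_rel_interior \<Delta> f P \<and> x j \<in> dual_rel_interior \<Delta> f P)"
  shows "weighting (dual_complex \<Delta> f) (point_weighting \<Delta> f K x m)"
  unfolding weighting_def
proof
  obtain V where V: "finite V" "V \<noteq> {}" "V = lattice_points V" "\<Delta> = convex hull V"
    using assms(1) unfolding lattice_polytope_def by blast
  then have bdd: "bounded \<Delta>"
    by (simp add: bounded_convex_hull finite_imp_bounded)
  then have fin: "finite (lattice_points \<Delta>)" by (rule finite_lattice_points)
  have "V \<subseteq> lattice_points \<Delta>"
    using V(3,4) hull_subset[of V convex] unfolding lattice_points_def by blast
  then have ne: "lattice_points \<Delta> \<noteq> {}" using V(2) by blast
  fix P assume P: "P \<in> dual_complex \<Delta> f"
  have le: "card (min_support \<Delta> f y) \<le> card (lattice_points P)"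
    and pos: "card (min_support \<Delta> f y) \<ge> 1"
    if y: "P = convex hull (min_support \<Delta> f y)" for y
  proof -
    have sub: "min_support \<Delta> f y \<subseteq> lattice_points \<Delta>"
      unfolding min_support_def by blast
    then have fin': "finite (min_support \<Delta> f y)" using fin finite_subset by blast
    then have "finite (lattice_points P)"
      unfolding y by (intro finite_lattice_points bounded_convex_hull finite_imp_bounded)
    moreover have "min_support \<Delta> f y \<subseteq> lattice_points P"
      using sub hull_subset[of "min_support \<Delta> f y" convex] unfolding y lattice_points_def by blast
    ultimately show "card (min_support \<Delta> f y) \<le> card (lattice_points P)"
      by (rule card_mono)
    have "trop_eval \<Delta> f y \<in> (\<lambda>I. f I + I \<bullet> y) ` lattice_points \<Delta>"
      unfolding trop_eval_def using fin ne by (intro Min_in) auto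
    then have "min_support \<Delta> f y \<noteq> {}"
      unfolding min_support_def by force
    then show "card (min_support \<Delta> f y) \<ge> 1"
      using fin' by (simp add: Suc_leI card_gt_0_iff)
  qed
  show "0 \<le> point_weighting \<Delta> f K x m P \<and>
        point_weighting \<Delta> f K x m P \<le> int (card (lattice_points P)) - 1"
  proof (cases "\<exists>i \<in> {1..K}. x i \<in> dual_rel_interior \<Delta> f P")
    case True
    then obtain i where i: "i \<in> {1..K}" "x i \<in> dual_rel_interior \<Delta> f P" by blast
    have "(THE i. i \<in> {1..K} \<and> x i \<in> dual_rel_interior \<Delta> f P) = i"
      by (rule the_equality) (use i distinct[OF _ i(1) _ P] in blast)+
    then have "point_weighting \<Delta> f K x m P = int (m i)"
      using True by (simp add: point_weighting_def)
    moreover have "P = convex hull (min_support \<Delta> f (x i))"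
      using i(2) unfolding dual_rel_interior_def by blast
    ultimately show ?thesis
      using le[of "x i"] pos[of "x i"] mult[OF i(1)] unfolding trop_mult_def by simp
  next
    case False
    obtain y where "P = convex hull (min_support \<Delta> f y)"
      using P unfolding dual_complex_def by blast
    then show ?thesis using le[of y] pos[of y] False by (simp add: point_weighting_def)
  qed
qed

end

theory Submission imports Defs begin

text \<open>
  Write \<open>F\<close> and \<open>G\<close> for the tropical functions \<open>y \<mapsto> min (f I + I \<bullet> y)\<close> of \<open>f\<close> and \<open>g\<close>, and
  \<open>B\<close> for the set of exponents that attain the minimum of \<open>f\<close> at a given point. A saturated
  coefficient function is the restriction to the lattice points of a convex function: at every
  exponent it has a supporting affine function. Two consequences carry most of the argument.
  The lattice points of a cell are exactly the exponents that attain the minimum at a point dual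
  to it (\<open>saturated_cell_Int\<close>), and, since every cell is the convex hull of vertices of the dual
  complex (\<open>min_support_subset_hull_vertices\<close>), a saturated \<open>g\<close> that lies above \<open>f + c\<close> and
  touches it at all these vertices is equal to \<open>f + c\<close> (\<open>saturated_eq_if_eq_on_vertices\<close>).

  Suppose first that the weighting is rigid, and let \<open>g\<close> be saturated with the prescribed
  multiplicities. Let \<open>c\<close> be the minimum of \<open>g - f\<close> and \<open>L\<close> the set where it is attained. At a
  point \<open>x\<close> where \<open>B\<close> meets \<open>L\<close>, the exponents minimal for \<open>g\<close> are precisely those in
  \<open>B \<inter> L\<close>, so the multiplicity of \<open>g\<close> at \<open>x\<close> bounds the number of points of \<open>L\<close> in the cell
  from below. Hence \<open>L\<close> is deformable unless it contains all vertices, in which case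
  \<open>g = f + c\<close> (\<open>deformable_argmin_diff\<close>). Rigidity leaves the second alternative, and adding a
  constant to all coefficients changes no set of minimal exponents.

  Conversely, let \<open>L\<close> be deformable. Lowering the coefficients of \<open>f\<close> on \<open>L\<close> by a small \<open>e\<close>
  keeps all of \<open>B\<close> minimal at the points where \<open>B\<close> misses \<open>L\<close>, and keeps \<open>B \<inter> L\<close> minimal at the
  other points, so the prescribed multiplicities survive. The new polynomial need not be
  saturated, but only finitely many points matter, and a polynomial can be saturated without
  changing its tropical function on a given finite set of points (\<open>exists_saturated_below\<close>).
  It remains to see that the hypersurface has changed (\<open>exists_deformation\<close>). If it had not,
  then \<open>F\<close> and \<open>G\<close> would be affine with the same slopes on the same regions of the complement,
  so \<open>G - F\<close> would be constant (\<open>trop_eval_diff_const_if_hypersurface_eq\<close>). But \<open>G - F\<close> vanishes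
  at a point where a vertex outside \<open>L\<close> is the only minimal exponent, and is at most \<open>- e\<close> at a
  point where an element of \<open>L\<close> is minimal for \<open>f\<close>.
\<close>

section \<open>Tropical functions and minimal exponents\<close>

lemma lattice_polytope_finite:
  assumes "lattice_polytope \<Delta>"
  shows "finite (lattice_points \<Delta>)"
proof -
  obtain V where "finite V" "\<Delta> = convex hull V"
    using assms unfolding lattice_polytope_def by blast
  then show ?thesis
    by (simp add: finite_lattice_points bounded_convex_hull finite_imp_bounded)
qed

lemma lattice_polytope_nonempty:
  assumes "lattice_polytope \<Delta>"
  shows "lattice_points \<Delta> \<noteq> {}"
proof -
  obtain V where V: "V \<noteq> {}" "V = lattice_points V" "\<Delta> = convex hull V"
    using assms unfolding lattice_polytope_def by blast
  have "V \<subseteq> lattice_points \<Delta>"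
    using V(2,3) hull_subset[of V convex] unfolding lattice_points_def by blast
  then show ?thesis using V(1) by blast
qed

lemma trop_eval_le:
  assumes "lattice_polytope \<Delta>" "J \<in> lattice_points \<Delta>"
  shows "trop_eval \<Delta> f y \<le> f J + J \<bullet> y"
  unfolding trop_eval_def using assms(2) lattice_polytope_finite[OF assms(1)] by (intro Min_le) auto

lemma trop_eval_greatest:
  assumes "lattice_polytope \<Delta>" "\<And>J. J \<in> lattice_points \<Delta> \<Longrightarrow> c \<le> f J + J \<bullet> y"
  shows "c \<le> trop_eval \<Delta> f y"
  unfolding trop_eval_def
  using assms(2) lattice_polytope_finite[OF assms(1)] lattice_polytope_nonempty[OF assms(1)]
  by (intro Min.boundedI) auto

lemma min_support_subset: "min_support \<Delta> f y \<subseteq> lattice_points \<Delta>"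
  unfolding min_support_def by blast

lemma min_supportD: "I \<in> min_support \<Delta> f y \<Longrightarrow> f I + I \<bullet> y = trop_eval \<Delta> f y"
  unfolding min_support_def by blast

lemma min_supportI:
  assumes "lattice_polytope \<Delta>" "I \<in> lattice_points \<Delta>" "f I + I \<bullet> y \<le> trop_eval \<Delta> f y"
  shows "I \<in> min_support \<Delta> f y"
  unfolding min_support_def using trop_eval_le[OF assms(1,2), of f y] assms(2,3) by (simp add: order_antisym)

lemma finite_min_support:
  assumes "lattice_polytope \<Delta>"
  shows "finite (min_support \<Delta> f y)"
  by (rule finite_subset[OF min_support_subset lattice_polytope_finite[OF assms]])

lemma min_support_nonempty:
  assumes "lattice_polytope \<Delta>"
  shows "min_support \<Delta> f y \<noteq> {}"
proof -
  have "trop_eval \<Delta> f y \<in> (\<lambda>I. f I + I \<bullet> y) ` lattice_points \<Delta>"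
    unfolding trop_eval_def using lattice_polytope_finite[OF assms] lattice_polytope_nonempty[OF assms]
    by (intro Min_in) auto
  then show ?thesis unfolding min_support_def by force
qed

lemma min_support_singletonI:
  assumes "lattice_polytope \<Delta>" "v \<in> lattice_points \<Delta>"
    and "\<And>J. J \<in> lattice_points \<Delta> \<Longrightarrow> J \<noteq> v \<Longrightarrow> f v + v \<bullet> y < f J + J \<bullet> y"
  shows "min_support \<Delta> f y = {v}"
proof -
  have "min_support \<Delta> f y \<subseteq> {v}"
  proof
    fix I assume I: "I \<in> min_support \<Delta> f y"
    then have "f I + I \<bullet> y \<le> f v + v \<bullet> y"
      using min_supportD[OF I] trop_eval_le[OF assms(1,2), of f y] by simp
    moreover have "I \<in> lattice_points \<Delta>" using I min_support_subset by blast
    ultimately show "I \<in> {v}" using assms(3)[of I] by (cases "I = v") simp_all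
  qed
  then show ?thesis using min_support_nonempty[OF assms(1), of f y] by blast
qed

lemma not_in_hypersurface_iff:
  assumes "lattice_polytope \<Delta>"
  shows "y \<notin> hypersurface \<Delta> f \<longleftrightarrow> (\<exists>v. min_support \<Delta> f y = {v})"
proof
  assume "y \<notin> hypersurface \<Delta> f"
  then have "card (min_support \<Delta> f y) < 2" by (simp add: hypersurface_def)
  moreover have "card (min_support \<Delta> f y) > 0"
    using min_support_nonempty[OF assms] finite_min_support[OF assms] by (simp add: card_gt_0_iff)
  ultimately have "card (min_support \<Delta> f y) = 1" by linarith
  then show "\<exists>v. min_support \<Delta> f y = {v}" by (meson card_1_singletonE)
next
  assume "\<exists>v. min_support \<Delta> f y = {v}"
  then show "y \<notin> hypersurface \<Delta> f" by (auto simp: hypersurface_def)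
qed

lemma min_support_cong_add_const:
  assumes "\<And>I. I \<in> lattice_points \<Delta> \<Longrightarrow> g I = f I + c" and \<Delta>: "lattice_polytope \<Delta>"
  shows "min_support \<Delta> g = min_support \<Delta> f"
proof
  fix y
  have "trop_eval \<Delta> g y = trop_eval \<Delta> f y + c"
  proof (rule antisym)
    have "trop_eval \<Delta> g y - c \<le> f J + J \<bullet> y" if "J \<in> lattice_points \<Delta>" for J
      using trop_eval_le[OF \<Delta> that, of g y] assms(1)[OF that] by simp
    then show "trop_eval \<Delta> g y \<le> trop_eval \<Delta> f y + c"
      using trop_eval_greatest[OF \<Delta>, of "trop_eval \<Delta> g y - c" f y] by simp
    have "trop_eval \<Delta> f y + c \<le> g J + J \<bullet> y" if "J \<in> lattice_points \<Delta>" for J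
      using trop_eval_le[OF \<Delta> that, of f y] assms(1)[OF that] by simp
    then show "trop_eval \<Delta> f y + c \<le> trop_eval \<Delta> g y"
      by (rule trop_eval_greatest[OF \<Delta>])
  qed
  then show "min_support \<Delta> g y = min_support \<Delta> f y"
    unfolding min_support_def using assms(1) by auto
qed

lemma convex_hull_eq_singletonD:
  assumes "convex hull S = {v}"
  shows "S = {v}"
proof -
  have "S \<noteq> {}" using assms by auto
  moreover have "S \<subseteq> {v}" using assms hull_subset[of S convex] by simp
  ultimately show ?thesis by blast
qed

lemma cell_vertices_iff:
  "v \<in> cell_vertices (dual_complex \<Delta> f) \<longleftrightarrow> (\<exists>y. min_support \<Delta> f y = {v})"
proof
  assume "v \<in> cell_vertices (dual_complex \<Delta> f)"
  then obtain y where "convex hull min_support \<Delta> f y = {v}"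
    unfolding cell_vertices_def dual_complex_def by auto
  then show "\<exists>y. min_support \<Delta> f y = {v}" using convex_hull_eq_singletonD by blast
next
  assume "\<exists>y. min_support \<Delta> f y = {v}"
  then obtain y where "min_support \<Delta> f y = {v}" by blast
  then have "{v} = convex hull min_support \<Delta> f y" by simp
  then show "v \<in> cell_vertices (dual_complex \<Delta> f)"
    unfolding cell_vertices_def dual_complex_def by blast
qed

section \<open>Small perturbations\<close>

lemma uniform_scale:
  fixes r s :: "'a \<Rightarrow> real"
  assumes "finite A" "\<And>a. a \<in> A \<Longrightarrow> 0 < r a"
  obtains t where "0 < t" "\<And>a. a \<in> A \<Longrightarrow> t * s a < r a"
proof -
  have "\<forall>\<^sub>F t in at_right 0. t * s a < r a" if "a \<in> A" for a
  proof -
    have "((\<lambda>t. t * s a) \<longlongrightarrow> 0 * s a) (at_right 0)" by (intro tendsto_intros)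
    then show ?thesis using order_tendstoD(2) assms(2)[OF that] by fastforce
  qed
  then have "\<forall>\<^sub>F t in at_right 0. \<forall>a\<in>A. t * s a < r a"
    using assms(1) by (intro eventually_ball_finite) auto
  moreover have "\<forall>\<^sub>F t in at_right (0::real). 0 < t"
    by (simp add: eventually_at_right_less)
  ultimately have "\<forall>\<^sub>F t in at_right 0. 0 < t \<and> (\<forall>a\<in>A. t * s a < r a)"
    by eventually_elim auto
  then obtain t where "0 < t" "\<forall>a\<in>A. t * s a < r a"
    using eventually_happens' trivial_limit_at_right_real by blast
  then show ?thesis using that by blast
qed

text \<open>
  Perturbing the coefficients by at most \<open>e\<close> creates no new minimal exponent at the points
  of \<open>S\<close> as long as some old one is not raised.
\<close>
lemma min_support_gap:
  assumes \<Delta>: "lattice_polytope \<Delta>" and "finite S"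
  obtains e where "0 < e"
    "\<And>y J. \<lbrakk>y \<in> S; J \<in> lattice_points \<Delta>; J \<notin> min_support \<Delta> f y\<rbrakk> \<Longrightarrow> trop_eval \<Delta> f y + e < f J + J \<bullet> y"
proof -
  define A where "A = {(y, J). y \<in> S \<and> J \<in> lattice_points \<Delta> \<and> J \<notin> min_support \<Delta> f y}"
  have "A \<subseteq> S \<times> lattice_points \<Delta>" unfolding A_def by blast
  then have "finite A"
    by (rule finite_subset) (intro finite_cartesian_product \<open>finite S\<close> lattice_polytope_finite[OF \<Delta>])
  moreover have "0 < f (snd a) + snd a \<bullet> fst a - trop_eval \<Delta> f (fst a)" if "a \<in> A" for a
    using that min_supportI[OF \<Delta>, of "snd a" f "fst a"] unfolding A_def by fastforce
  ultimately obtain e where e: "0 < e"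
    "\<And>a. a \<in> A \<Longrightarrow> e * 1 < f (snd a) + snd a \<bullet> fst a - trop_eval \<Delta> f (fst a)"
    using uniform_scale[of A "\<lambda>a. f (snd a) + snd a \<bullet> fst a - trop_eval \<Delta> f (fst a)" "\<lambda>_. 1"]
    by blast
  show ?thesis
  proof (rule that[OF e(1)])
    fix y J assume "y \<in> S" "J \<in> lattice_points \<Delta>" "J \<notin> min_support \<Delta> f y"
    then have "(y, J) \<in> A" unfolding A_def by blast
    then show "trop_eval \<Delta> f y + e < f J + J \<bullet> y" using e(2)[of "(y, J)"] by simp
  qed
qed

section \<open>Saturated polynomials are convex\<close>

text \<open>
  The value of \<open>f\<close> at \<open>I\<close> is attained by an affine function lying below \<open>f\<close> on all
  lattice points. An affine upper bound for \<open>f\<close> on \<open>S\<close> is an upper bound for this affine function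
  on the convex hull of \<open>S\<close>.
\<close>
lemma saturated_affine_bound:
  assumes \<Delta>: "lattice_polytope \<Delta>" and "saturated \<Delta> f" and I: "I \<in> lattice_points \<Delta>"
    and "S \<subseteq> lattice_points \<Delta>" "I \<in> convex hull S"
    and bound: "\<And>J. J \<in> S \<Longrightarrow> f J + J \<bullet> y \<le> c"
  shows "f I + I \<bullet> y \<le> c"
proof -
  obtain z where z: "I \<in> min_support \<Delta> f z"
    using \<open>saturated \<Delta> f\<close> I unfolding saturated_def by blast
  have "S \<subseteq> {J. (z - y) \<bullet> J \<ge> f I + I \<bullet> z - c}"
  proof
    fix J assume "J \<in> S"
    then have "f I + I \<bullet> z \<le> f J + J \<bullet> z"
      using min_supportD[OF z] trop_eval_le[OF \<Delta>, of J f z] assms(4) by auto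
    then show "J \<in> {J. (z - y) \<bullet> J \<ge> f I + I \<bullet> z - c}"
      using bound[OF \<open>J \<in> S\<close>] by (simp add: inner_diff_right inner_commute[of _ J])
  qed
  then have "convex hull S \<subseteq> {J. (z - y) \<bullet> J \<ge> f I + I \<bullet> z - c}"
    by (intro hull_minimal convex_halfspace_ge)
  then have "(z - y) \<bullet> I \<ge> f I + I \<bullet> z - c" using \<open>I \<in> convex hull S\<close> by blast
  then show ?thesis by (simp add: inner_diff_right inner_commute[of _ I])
qed

text \<open>
  Without saturation a cell can contain lattice points whose monomials are nowhere minimal.
\<close>
lemma saturated_cell_Int:
  assumes \<Delta>: "lattice_polytope \<Delta>" and "saturated \<Delta> f" and "L \<subseteq> lattice_points \<Delta>"
  shows "(convex hull min_support \<Delta> f y) \<inter> L = min_support \<Delta> f y \<inter> L"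
proof -
  have "I \<in> min_support \<Delta> f y" if "I \<in> convex hull min_support \<Delta> f y" "I \<in> L" for I
    using that assms(3) min_supportD[of _ \<Delta> f y]
    by (intro min_supportI[OF \<Delta>] saturated_affine_bound[OF assms(1,2) _ min_support_subset that(1)]) auto
  then show ?thesis using hull_subset[of "min_support \<Delta> f y" convex] by blast
qed

text \<open>
  Extreme points of a polytope are exposed, so some direction \<open>a\<close> is maximised over the cell at
  \<open>v\<close> only. Moving \<open>y\<close> slightly in the direction \<open>- a\<close> makes \<open>v\<close> the only minimal exponent.
\<close>
lemma extreme_point_cell_vertex:
  assumes \<Delta>: "lattice_polytope \<Delta>" and v: "v extreme_point_of (convex hull min_support \<Delta> f y)"
  shows "v \<in> cell_vertices (dual_complex \<Delta> f)"
proof -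
  let ?B = "min_support \<Delta> f y"
  let ?F = "trop_eval \<Delta> f y"
  have vB: "v \<in> ?B" using v by (rule extreme_point_of_convex_hull)
  have poly: "polyhedron (convex hull ?B)"
    using finite_min_support[OF \<Delta>] by (metis polytope_def polytope_imp_polyhedron)
  have "{v} exposed_face_of (convex hull ?B)"
    using v by (simp add: exposed_face_of_polyhedron[OF poly] face_of_singleton)
  then obtain a b where ab: "convex hull ?B \<subseteq> {x. a \<bullet> x \<le> b}" "{v} = (convex hull ?B) \<inter> {x. a \<bullet> x = b}"
    unfolding exposed_face_of_def by blast
  have av: "a \<bullet> v = b" using ab(2) by blast
  have below: "a \<bullet> J < b" if "J \<in> ?B" "J \<noteq> v" for J
  proof -
    have "J \<in> convex hull ?B" using that(1) by (simp add: hull_inc)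
    then have "a \<bullet> J \<le> b" "a \<bullet> J \<noteq> b" using ab that(2) by blast+
    then show ?thesis by simp
  qed
  have "finite (lattice_points \<Delta> - ?B)" using lattice_polytope_finite[OF \<Delta>] by simp
  moreover have "0 < f J + J \<bullet> y - ?F" if "J \<in> lattice_points \<Delta> - ?B" for J
    using that min_supportI[OF \<Delta>, of J f y] by (auto simp: not_le[symmetric])
  ultimately obtain t where t: "0 < t"
    "\<And>J. J \<in> lattice_points \<Delta> - ?B \<Longrightarrow> t * (a \<bullet> J - b) < f J + J \<bullet> y - ?F"
    using uniform_scale[of "lattice_points \<Delta> - ?B" "\<lambda>J. f J + J \<bullet> y - ?F" "\<lambda>J. a \<bullet> J - b"] by metis
  have "min_support \<Delta> f (y - t *\<^sub>R a) = {v}"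
  proof (rule min_support_singletonI[OF \<Delta>])
    show "v \<in> lattice_points \<Delta>" using vB min_support_subset by blast
    fix J assume J: "J \<in> lattice_points \<Delta>" "J \<noteq> v"
    have "?F - t * b < f J + J \<bullet> y - t * (a \<bullet> J)"
    proof (cases "J \<in> ?B")
      case True
      then show ?thesis using below[OF True J(2)] t(1) min_supportD[OF True] by simp
    next
      case False
      then show ?thesis using t(2)[of J] J(1) by (simp add: algebra_simps)
    qed
    then show "f v + v \<bullet> (y - t *\<^sub>R a) < f J + J \<bullet> (y - t *\<^sub>R a)"
      using min_supportD[OF vB] av by (simp add: inner_diff_right inner_commute)
  qed
  then show ?thesis using cell_vertices_iff by blast
qed

lemma min_support_subset_hull_vertices:
  assumes \<Delta>: "lattice_polytope \<Delta>"
  shows "min_support \<Delta> f y \<subseteq> convex hull (min_support \<Delta> f y \<inter> cell_vertices (dual_complex \<Delta> f))"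
proof -
  let ?B = "min_support \<Delta> f y"
  have "{v. v extreme_point_of (convex hull ?B)} \<subseteq> ?B \<inter> cell_vertices (dual_complex \<Delta> f)"
    using extreme_point_cell_vertex[OF \<Delta>] extreme_point_of_convex_hull by fast
  moreover have "convex hull ?B = convex hull {v. v extreme_point_of (convex hull ?B)}"
    by (intro Krein_Milman_Minkowski finite_imp_compact_convex_hull finite_min_support[OF \<Delta>]
        convex_convex_hull)
  ultimately have "convex hull ?B \<subseteq> convex hull (?B \<inter> cell_vertices (dual_complex \<Delta> f))"
    using hull_mono by metis
  then show ?thesis using hull_subset[of ?B convex] by (rule order_trans[rotated])
qed

text \<open>
  Each exponent is minimal for \<open>f\<close> somewhere, so it lies in a cell on whose lattice points \<open>f\<close> is
  affine, and this cell is spanned by vertices. Convexity of \<open>g\<close> therefore gives \<open>g \<le> f + c\<close> on the whole cell.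
\<close>
lemma saturated_eq_if_eq_on_vertices:
  assumes \<Delta>: "lattice_polytope \<Delta>" and f: "saturated \<Delta> f" and g: "saturated \<Delta> g"
    and ge: "\<And>I. I \<in> lattice_points \<Delta> \<Longrightarrow> f I + c \<le> g I"
    and eq: "\<And>v. v \<in> cell_vertices (dual_complex \<Delta> f) \<Longrightarrow> g v = f v + c"
    and I: "I \<in> lattice_points \<Delta>"
  shows "g I = f I + c"
proof -
  obtain y where y: "I \<in> min_support \<Delta> f y" using f I unfolding saturated_def by blast
  let ?S = "min_support \<Delta> f y \<inter> cell_vertices (dual_complex \<Delta> f)"
  have "g I + I \<bullet> y \<le> trop_eval \<Delta> f y + c"
  proof (rule saturated_affine_bound[OF \<Delta> g I])
    show "?S \<subseteq> lattice_points \<Delta>" using min_support_subset by blast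
    show "I \<in> convex hull ?S" using y min_support_subset_hull_vertices[OF \<Delta>] by blast
    show "g J + J \<bullet> y \<le> trop_eval \<Delta> f y + c" if "J \<in> ?S" for J
      using that eq[of J] min_supportD[of J \<Delta> f y] by auto
  qed
  then show ?thesis using min_supportD[OF y] ge[OF I] by simp
qed

section \<open>Saturating on a finite set of points\<close>

text \<open>
  The convex envelope of \<open>h\<close> would serve for all points at once, but restricting the supporting
  affine functions to those given by points of the finite set \<open>S\<close> turns the supremum that defines it
  into a maximum. It is attained, which is exactly what saturation asks for.
\<close>
lemma exists_saturated_below:
  assumes \<Delta>: "lattice_polytope \<Delta>" and S: "finite S" "S \<noteq> {}"
  obtains g where "saturated \<Delta> g"
    and "\<And>I. I \<in> lattice_points \<Delta> \<Longrightarrow> g I \<le> h I"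
    and "\<And>y. y \<in> S \<Longrightarrow> trop_eval \<Delta> g y = trop_eval \<Delta> h y"
    and "\<And>y. y \<in> S \<Longrightarrow> min_support \<Delta> h y \<subseteq> min_support \<Delta> g y"
proof -
  (* A finite piece of the Legendre transform of the tropical function of h. *)
  define g where "g I = Max ((\<lambda>y. trop_eval \<Delta> h y - I \<bullet> y) ` S)" for I
  have ge: "trop_eval \<Delta> h y \<le> g I + I \<bullet> y" if "y \<in> S" for I y
  proof -
    have "trop_eval \<Delta> h y - I \<bullet> y \<le> g I" unfolding g_def using S that by (intro Max_ge) auto
    then show ?thesis by simp
  qed
  have attained: "\<exists>y\<in>S. g I + I \<bullet> y = trop_eval \<Delta> h y" for I
  proof -
    have "g I \<in> (\<lambda>y. trop_eval \<Delta> h y - I \<bullet> y) ` S" unfolding g_def using S by (intro Max_in) auto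
    then show ?thesis by force
  qed
  have le: "g I \<le> h I" if "I \<in> lattice_points \<Delta>" for I
  proof -
    obtain y where "g I + I \<bullet> y = trop_eval \<Delta> h y" using attained by blast
    then show ?thesis using trop_eval_le[OF \<Delta> that, of h y] by simp
  qed
  have eval: "trop_eval \<Delta> g y = trop_eval \<Delta> h y" if "y \<in> S" for y
  proof (rule antisym)
    show "trop_eval \<Delta> g y \<le> trop_eval \<Delta> h y"
      using trop_eval_le[OF \<Delta>, of _ g y] le
      by (intro trop_eval_greatest[OF \<Delta>]) (meson add_mono_thms_linordered_semiring(3) order_trans)
    show "trop_eval \<Delta> h y \<le> trop_eval \<Delta> g y"
      using ge[OF that] by (intro trop_eval_greatest[OF \<Delta>])
  qed
  have "saturated \<Delta> g"
    unfolding saturated_def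
  proof
    fix I assume I: "I \<in> lattice_points \<Delta>"
    obtain y where "y \<in> S" "g I + I \<bullet> y = trop_eval \<Delta> h y" using attained by blast
    then have "I \<in> min_support \<Delta> g y" using eval[of y] I by (intro min_supportI[OF \<Delta>]) auto
    then show "\<exists>y. I \<in> min_support \<Delta> g y" by blast
  qed
  moreover have "min_support \<Delta> h y \<subseteq> min_support \<Delta> g y" if "y \<in> S" for y
  proof
    fix I assume I: "I \<in> min_support \<Delta> h y"
    then have IZ: "I \<in> lattice_points \<Delta>" using min_support_subset by blast
    then show "I \<in> min_support \<Delta> g y"
      using le[OF IZ] min_supportD[OF I] eval[OF that] by (intro min_supportI[OF \<Delta>]) auto
  qed
  ultimately show ?thesis using that le eval by blast
qed

section \<open>Polynomials with the same hypersurface\<close>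

lemma continuous_on_trop_eval:
  assumes \<Delta>: "lattice_polytope \<Delta>"
  shows "continuous_on UNIV (trop_eval \<Delta> f)"
proof -
  have "continuous_on UNIV (\<lambda>y. Min ((\<lambda>I. f I + I \<bullet> y) ` A))"
    if "finite A" "A \<noteq> {}" for A :: "(real ^ 'a) set"
    using that
  proof (induction A rule: finite_ne_induct)
    case (singleton I)
    then show ?case by (auto intro!: continuous_intros)
  next
    case (insert I A)
    then have "(\<lambda>y. Min ((\<lambda>I. f I + I \<bullet> y) ` insert I A))
        = (\<lambda>y. min (f I + I \<bullet> y) (Min ((\<lambda>I. f I + I \<bullet> y) ` A)))"
      by (intro ext) (simp add: Min_insert)
    moreover have "continuous_on UNIV (\<lambda>y. min (f I + I \<bullet> y) (Min ((\<lambda>I. f I + I \<bullet> y) ` A)))"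
      using insert.IH by (intro continuous_intros)
    ultimately show ?case by metis
  qed
  from this[OF lattice_polytope_finite[OF \<Delta>] lattice_polytope_nonempty[OF \<Delta>]]
  show ?thesis by (simp add: trop_eval_def[abs_def])
qed

lemma open_linearity_region:
  assumes \<Delta>: "lattice_polytope \<Delta>"
  shows "open {y. min_support \<Delta> f y = {v}}"
proof (cases "v \<in> lattice_points \<Delta>")
  case True
  have "{y. min_support \<Delta> f y = {v}}
      = (\<Inter>J\<in>lattice_points \<Delta> - {v}. {y. f v + v \<bullet> y < f J + J \<bullet> y})" (is "?U = ?R")
  proof
    show "?R \<subseteq> ?U" using min_support_singletonI[OF \<Delta> True] by auto
    show "?U \<subseteq> ?R"
    proof clarsimp
      fix y J assume y: "min_support \<Delta> f y = {v}" and J: "J \<in> lattice_points \<Delta>" "J \<noteq> v"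
      have "f v + v \<bullet> y = trop_eval \<Delta> f y" using y min_supportD by blast
      moreover have "\<not> f J + J \<bullet> y \<le> trop_eval \<Delta> f y"
        using min_supportI[OF \<Delta> J(1)] y J(2) by blast
      ultimately show "f v + v \<bullet> y < f J + J \<bullet> y" by simp
    qed
  qed
  also have "open \<dots>"
    using lattice_polytope_finite[OF \<Delta>]
    by (intro open_INT finite_Diff ballI open_Collect_less continuous_intros)
  finally show ?thesis .
next
  case False
  then have "{y. min_support \<Delta> f y = {v}} = {}" using min_support_subset by blast
  then show ?thesis by simp
qed

lemma min_support_along_segment:
  assumes \<Delta>: "lattice_polytope \<Delta>" and v: "v \<in> min_support \<Delta> f y" and z: "min_support \<Delta> f z = {v}"
    and t: "0 < t" "t \<le> 1"
  shows "min_support \<Delta> f ((1 - t) *\<^sub>R y + t *\<^sub>R z) = {v}"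
proof (rule min_support_singletonI[OF \<Delta>])
  show vZ: "v \<in> lattice_points \<Delta>" using v min_support_subset by blast
  fix J assume J: "J \<in> lattice_points \<Delta>" "J \<noteq> v"
  have "f v + v \<bullet> y \<le> f J + J \<bullet> y"
    using min_supportD[OF v] trop_eval_le[OF \<Delta> J(1)] by simp
  then have 1: "(1 - t) * (f v + v \<bullet> y) \<le> (1 - t) * (f J + J \<bullet> y)"
    using t by (intro mult_left_mono) auto
  have "\<not> f J + J \<bullet> z \<le> trop_eval \<Delta> f z"
    using min_supportI[OF \<Delta> J(1)] z J(2) by blast
  then have "f v + v \<bullet> z < f J + J \<bullet> z" using min_supportD[of v \<Delta> f z] z by simp
  then have 2: "t * (f v + v \<bullet> z) < t * (f J + J \<bullet> z)" using t by simp
  have "f I + I \<bullet> ((1 - t) *\<^sub>R y + t *\<^sub>R z) = (1 - t) * (f I + I \<bullet> y) + t * (f I + I \<bullet> z)" for I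
    by (simp add: inner_add_right algebra_simps)
  then show "f v + v \<bullet> ((1 - t) *\<^sub>R y + t *\<^sub>R z) < f J + J \<bullet> ((1 - t) *\<^sub>R y + t *\<^sub>R z)"
    using 1 2 by simp
qed

text \<open>
  Along the segment from \<open>z\<close> to \<open>y\<close>, the end \<open>y\<close> excluded, \<open>v\<close> is the only minimal exponent of
  \<open>f\<close>. The half-open segment thus avoids the common hypersurface, so the minimal exponent of \<open>g\<close>
  is unique along it as well. Where it is unique it is locally constant, and by connectedness it
  remains the exponent \<open>v\<close> that it is at \<open>z\<close>. At \<open>y\<close> the claim follows by continuity.
\<close>
lemma min_support_transfer:
  assumes \<Delta>: "lattice_polytope \<Delta>" and V: "hypersurface \<Delta> g = hypersurface \<Delta> f"
    and v: "v \<in> min_support \<Delta> f y"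
    and z: "min_support \<Delta> f z = {v}" "min_support \<Delta> g z = {v}"
  shows "v \<in> min_support \<Delta> g y"
proof -
  define p where "p t = (1 - t) *\<^sub>R y + t *\<^sub>R z" for t :: real
  define U where "U w = {t. min_support \<Delta> g (p t) = {w}}" for w
  have cont: "continuous_on UNIV p" unfolding p_def by (intro continuous_intros)
  have opn: "open (U w)" for w
    using open_vimage[OF open_linearity_region[OF \<Delta>, of g w] cont] by (simp add: U_def vimage_def)
  have cover: "{0<..1} \<subseteq> (\<Union>w. U w)"
  proof
    fix t :: real assume "t \<in> {0<..1}"
    then have "min_support \<Delta> f (p t) = {v}"
      using min_support_along_segment[OF \<Delta> v z(1), of t] by (simp add: p_def)
    then have "p t \<notin> hypersurface \<Delta> g" using V not_in_hypersurface_iff[OF \<Delta>] by blast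
    then show "t \<in> (\<Union>w. U w)" using not_in_hypersurface_iff[OF \<Delta>] by (auto simp: U_def)
  qed
  have "1 \<in> U v" using z by (simp add: U_def p_def)
  have "{0<..1} \<subseteq> U v"
  proof -
    have "open (\<Union>w\<in>-{v}. U w)" using opn by blast
    moreover have "U v \<inter> (\<Union>w\<in>-{v}. U w) = {}" by (auto simp: U_def)
    moreover have "{0<..1} \<subseteq> U v \<union> (\<Union>w\<in>-{v}. U w)" using cover by blast
    moreover have "U v \<inter> {0<..1} \<noteq> {}" using \<open>1 \<in> U v\<close> by force
    moreover have "connected {0<..1::real}" by simp
    ultimately have "(\<Union>w\<in>-{v}. U w) \<inter> {0<..1} = {}"
      using connectedD[of "{0<..1::real}" "U v" "\<Union>w\<in>-{v}. U w"] opn by blast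
    moreover have "t \<in> U v" if t: "t \<in> {0<..1}" "t \<notin> (\<Union>w\<in>-{v}. U w)" for t
    proof -
      obtain w where "t \<in> U w" using t(1) cover by blast
      then show ?thesis using t(2) by (cases "w = v") simp_all
    qed
    ultimately show ?thesis by fast
  qed
  then have eqt: "g v + v \<bullet> p t = trop_eval \<Delta> g (p t)" if "0 < t" "t \<le> 1" for t
  proof -
    have "t \<in> U v" using \<open>{0<..1} \<subseteq> U v\<close> that by (meson greaterThanAtMost_iff subsetD)
    then show ?thesis by (intro min_supportD) (simp add: U_def)
  qed
  have "((\<lambda>t. g v + v \<bullet> p t - trop_eval \<Delta> g (p t)) \<longlongrightarrow> g v + v \<bullet> p 0 - trop_eval \<Delta> g (p 0)) (at_right 0)"
  proof -
    have "continuous_on UNIV (\<lambda>t. g v + v \<bullet> p t - trop_eval \<Delta> g (p t))"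
      using cont continuous_on_compose2[OF continuous_on_trop_eval[OF \<Delta>] cont]
      by (intro continuous_intros) auto
    then have "isCont (\<lambda>t. g v + v \<bullet> p t - trop_eval \<Delta> g (p t)) 0"
      by (simp add: continuous_on_eq_continuous_at)
    then show ?thesis unfolding isCont_def by (rule filterlim_mono[OF _ order.refl at_le]) simp
  qed
  moreover have "\<forall>\<^sub>F t in at_right 0. g v + v \<bullet> p t - trop_eval \<Delta> g (p t) = 0"
    using eventually_at_right_real[of 0 1] by (auto elim!: eventually_mono simp: eqt)
  ultimately have "g v + v \<bullet> p 0 - trop_eval \<Delta> g (p 0) = 0"
    by (intro tendsto_unique[OF trivial_limit_at_right_real _ tendsto_eventually])
  then show ?thesis
    using v min_support_subset by (intro min_supportI[OF \<Delta>]) (auto simp: p_def)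
qed

text \<open>
  The set \<open>hypersurface \<Delta> f\<close> alone does not remember the slopes on its complement: in dimension
  one, the same two points can carry jumps of slope \<open>1, 2\<close> or \<open>2, 1\<close>. The hypothesis that each
  vertex is the only minimal exponent of both polynomials at a common point identifies the
  slopes. The difference of the tropical functions is then continuous and takes only the finitely
  many values \<open>g v - f v\<close>.
\<close>
lemma trop_eval_diff_const_if_hypersurface_eq:
  assumes \<Delta>: "lattice_polytope \<Delta>" and V: "hypersurface \<Delta> g = hypersurface \<Delta> f"
    and common: "\<And>v. v \<in> cell_vertices (dual_complex \<Delta> f)
      \<Longrightarrow> \<exists>z. min_support \<Delta> f z = {v} \<and> min_support \<Delta> g z = {v}"
  obtains c where "\<And>y. trop_eval \<Delta> g y = trop_eval \<Delta> f y + c"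
proof -
  have diff: "trop_eval \<Delta> g y - trop_eval \<Delta> f y \<in> (\<lambda>v. g v - f v) ` lattice_points \<Delta>" for y
  proof -
    have "min_support \<Delta> f y \<inter> cell_vertices (dual_complex \<Delta> f) \<noteq> {}"
      using min_support_subset_hull_vertices[OF \<Delta>, of f y] min_support_nonempty[OF \<Delta>, of f y]
      by (auto simp: convex_hull_eq_empty)
    then obtain v where v: "v \<in> min_support \<Delta> f y" "v \<in> cell_vertices (dual_complex \<Delta> f)" by blast
    then obtain z where z: "min_support \<Delta> f z = {v}" "min_support \<Delta> g z = {v}" using common by blast
    have "trop_eval \<Delta> g y = g v + v \<bullet> y"
      using min_supportD[OF min_support_transfer[OF \<Delta> V v(1) z]] by simp
    then have "trop_eval \<Delta> g y - trop_eval \<Delta> f y = g v - f v"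
      using min_supportD[OF v(1)] by simp
    then show ?thesis using v(1) min_support_subset by blast
  qed
  have "(\<lambda>y. trop_eval \<Delta> g y - trop_eval \<Delta> f y) constant_on UNIV"
  proof (rule continuous_finite_range_constant)
    show "continuous_on UNIV (\<lambda>y. trop_eval \<Delta> g y - trop_eval \<Delta> f y)"
      using continuous_on_trop_eval[OF \<Delta>] by (intro continuous_intros) auto
    show "finite (range (\<lambda>y. trop_eval \<Delta> g y - trop_eval \<Delta> f y))"
      using diff by (intro finite_subset[OF _ finite_imageI[OF lattice_polytope_finite[OF \<Delta>]]]) blast
  qed (rule connected_UNIV)
  then obtain c where "\<And>y. trop_eval \<Delta> g y - trop_eval \<Delta> f y = c"
    unfolding constant_on_def by blast
  then have "trop_eval \<Delta> g y = trop_eval \<Delta> f y + c" for y by (simp add: algebra_simps)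
  then show ?thesis using that by blast
qed

section \<open>Deformable sets and other hypersurfaces\<close>

text \<open>
  Where the minimal exponents of \<open>f\<close> meet the set \<open>L\<close> on which \<open>g - f\<close> is least, both \<open>f\<close> and
  \<open>g - f\<close> are minimised by the points of the intersection. So the exponents minimal for \<open>g\<close> lie
  in \<open>L\<close>, and the multiplicity of \<open>g\<close> counts points of \<open>L\<close> in the cell. The vertices cannot all
  lie in \<open>L\<close>, since \<open>g\<close> would then be \<open>f + c\<close>.
\<close>
lemma deformable_argmin_diff:
  assumes \<Delta>: "lattice_polytope \<Delta>" and f: "saturated \<Delta> f" and g: "saturated \<Delta> g"
    and min: "\<And>I. I \<in> lattice_points \<Delta> \<Longrightarrow> f I + c \<le> g I"
    and attained: "J \<in> lattice_points \<Delta>" "g J = f J + c"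
    and nonconst: "I \<in> lattice_points \<Delta>" "g I \<noteq> f I + c"
    and \<mu>: "\<And>y. \<mu> (convex hull min_support \<Delta> f y) > 0 \<Longrightarrow> \<exists>z.
        convex hull min_support \<Delta> f z = convex hull min_support \<Delta> f y \<and>
        \<mu> (convex hull min_support \<Delta> f y) \<le> int (trop_mult \<Delta> g z)"
  shows "deformable \<Delta> (dual_complex \<Delta> f) \<mu> {I \<in> lattice_points \<Delta>. g I = f I + c}"
    (is "deformable _ _ _ ?L")
  unfolding deformable_def
proof (intro conjI ballI)
  show "?L \<noteq> {}" using attained by blast
  show "?L \<subseteq> lattice_points \<Delta>" by blast
  show "\<not> cell_vertices (dual_complex \<Delta> f) \<subseteq> ?L"
    using saturated_eq_if_eq_on_vertices[OF \<Delta> f g min] nonconst by blast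
  fix P assume "P \<in> dual_complex \<Delta> f"
  then obtain y where P: "P = convex hull min_support \<Delta> f y" unfolding dual_complex_def by blast
  have fin: "finite (P \<inter> ?L)" using lattice_polytope_finite[OF \<Delta>] by simp
  show "card (P \<inter> ?L) = 0 \<or> \<mu> P + 1 \<le> int (card (P \<inter> ?L))"
  proof (cases "P \<inter> ?L = {}")
    case False
    show ?thesis
    proof (cases "\<mu> P > 0")
      case True
      then obtain z where z: "P = convex hull min_support \<Delta> f z" "\<mu> P \<le> int (trop_mult \<Delta> g z)"
        using \<mu>[of y] P by metis
      have PL: "P \<inter> ?L = min_support \<Delta> f z \<inter> ?L"
        unfolding z(1) by (rule saturated_cell_Int[OF \<Delta> f]) blast
      with False obtain I where I: "I \<in> min_support \<Delta> f z" "I \<in> ?L" by blast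
      have "min_support \<Delta> g z \<subseteq> P \<inter> ?L"
      proof
        fix J assume J: "J \<in> min_support \<Delta> g z"
        then have JZ: "J \<in> lattice_points \<Delta>" using min_support_subset by blast
        have "g J + J \<bullet> z \<le> g I + I \<bullet> z"
          using min_supportD[OF J] trop_eval_le[OF \<Delta>, of I g z] I(2) by simp
        also have "\<dots> = trop_eval \<Delta> f z + c" using min_supportD[OF I(1)] I(2) by simp
        finally have le: "g J + J \<bullet> z \<le> trop_eval \<Delta> f z + c" .
        then have "J \<in> min_support \<Delta> f z" using min[OF JZ] by (intro min_supportI[OF \<Delta> JZ]) simp
        moreover from this have "g J = f J + c" using le min[OF JZ] min_supportD[of J \<Delta> f z] by simp
        ultimately show "J \<in> P \<inter> ?L" using JZ PL by blast
      qed
      then have "card (min_support \<Delta> g z) \<le> card (P \<inter> ?L)" using fin by (intro card_mono)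
      moreover have "card (min_support \<Delta> g z) > 0"
        using min_support_nonempty[OF \<Delta>] finite_min_support[OF \<Delta>] by (simp add: card_gt_0_iff)
      ultimately show ?thesis using z(2) unfolding trop_mult_def by linarith
    next
      case nonpos: False
      have "card (P \<inter> ?L) > 0" using fin False by (simp add: card_gt_0_iff)
      then show ?thesis using nonpos by linarith
    qed
  qed simp
qed

text \<open>
  Lowering the coefficients on \<open>L\<close> by less than every gap between the minimum and the other
  monomials, at finitely many points, lets exponents of \<open>L\<close> win there only where they were already
  minimal. If \<open>L\<close> is deformable, it has enough exponents in each cell that it meets for the last
  two conclusions to preserve the prescribed multiplicities.
\<close>
lemma exists_deformation:
  assumes \<Delta>: "lattice_polytope \<Delta>" and f: "saturated \<Delta> f" and "finite X"
    and L: "L \<noteq> {}" "L \<subseteq> lattice_points \<Delta>" "\<not> cell_vertices (dual_complex \<Delta> f) \<subseteq> L"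
  obtains g where "saturated \<Delta> g" "hypersurface \<Delta> g \<noteq> hypersurface \<Delta> f"
    and "\<And>y. \<lbrakk>y \<in> X; min_support \<Delta> f y \<inter> L = {}\<rbrakk> \<Longrightarrow> min_support \<Delta> f y \<subseteq> min_support \<Delta> g y"
    and "\<And>y. y \<in> X \<Longrightarrow> min_support \<Delta> f y \<inter> L \<subseteq> min_support \<Delta> g y"
proof -
  let ?Z = "lattice_points \<Delta>" and ?V = "cell_vertices (dual_complex \<Delta> f)"
  have finZ: "finite ?Z" by (rule lattice_polytope_finite[OF \<Delta>])
  have VZ: "?V \<subseteq> ?Z" using min_support_subset cell_vertices_iff by blast
  obtain Y where Y: "\<And>v. v \<in> ?V \<Longrightarrow> min_support \<Delta> f (Y v) = {v}" using cell_vertices_iff by metis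
  obtain W where W: "\<And>I. I \<in> ?Z \<Longrightarrow> I \<in> min_support \<Delta> f (W I)" using f unfolding saturated_def by metis
  (* S contains the points of X, points that certify the vertices of the dual complex, and points
     that certify that f is saturated; the latter force g to stay within e of f. *)
  define S where "S = X \<union> Y ` ?V \<union> W ` ?Z"
  have finS: "finite S" unfolding S_def using \<open>finite X\<close> finZ finite_subset[OF VZ] by simp
  have neS: "S \<noteq> {}" unfolding S_def using lattice_polytope_nonempty[OF \<Delta>] by blast
  obtain e where e: "0 < e"
    "\<And>y J. \<lbrakk>y \<in> S; J \<in> ?Z; J \<notin> min_support \<Delta> f y\<rbrakk> \<Longrightarrow> trop_eval \<Delta> f y + e < f J + J \<bullet> y"
    using min_support_gap[OF \<Delta> finS] by blast
  define h where "h I = (if I \<in> L then f I - e else f I)" for I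
  have h_bounds: "f I - e \<le> h I" "h I \<le> f I" for I using e(1) by (auto simp: h_def)
  have eval_h: "trop_eval \<Delta> f y - e \<le> trop_eval \<Delta> h y" for y
  proof (rule trop_eval_greatest[OF \<Delta>])
    fix J assume "J \<in> ?Z"
    then show "trop_eval \<Delta> f y - e \<le> h J + J \<bullet> y"
      using trop_eval_le[OF \<Delta>, of J f y] h_bounds(1)[of J] by linarith
  qed
  have meets: "min_support \<Delta> f y \<inter> L \<subseteq> min_support \<Delta> h y" for y
  proof
    fix I assume "I \<in> min_support \<Delta> f y \<inter> L"
    then show "I \<in> min_support \<Delta> h y"
      using eval_h[of y] min_supportD[of I \<Delta> f y] L(2)
      by (intro min_supportI[OF \<Delta>]) (auto simp: h_def)
  qed
  have misses: "min_support \<Delta> f y \<subseteq> min_support \<Delta> h y" if "y \<in> S" "min_support \<Delta> f y \<inter> L = {}" for y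
  proof
    fix I assume I: "I \<in> min_support \<Delta> f y"
    have "trop_eval \<Delta> f y \<le> trop_eval \<Delta> h y"
    proof (rule trop_eval_greatest[OF \<Delta>])
      fix J assume J: "J \<in> ?Z"
      show "trop_eval \<Delta> f y \<le> h J + J \<bullet> y"
      proof (cases "J \<in> L")
        case True
        then show ?thesis using e(2)[OF that(1) J] that(2) by (force simp: h_def)
      next
        case False
        then show ?thesis using trop_eval_le[OF \<Delta> J] by (simp add: h_def)
      qed
    qed
    then show "I \<in> min_support \<Delta> h y"
      using I min_supportD[OF I] h_bounds(2)[of I] min_support_subset[of \<Delta> f y]
      by (intro min_supportI[OF \<Delta>]) auto
  qed
  obtain g where g: "saturated \<Delta> g"
    and gh: "\<And>I. I \<in> ?Z \<Longrightarrow> g I \<le> h I"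
    and eval_g: "\<And>y. y \<in> S \<Longrightarrow> trop_eval \<Delta> g y = trop_eval \<Delta> h y"
    and supp_g: "\<And>y. y \<in> S \<Longrightarrow> min_support \<Delta> h y \<subseteq> min_support \<Delta> g y"
    using exists_saturated_below[OF \<Delta> finS neS] by blast
  have g_ge: "f I - e \<le> g I" if "I \<in> ?Z" for I
  proof -
    have "W I \<in> S" using that by (simp add: S_def)
    then show ?thesis
      using trop_eval_le[OF \<Delta> that, of g "W I"] eval_g[of "W I"] eval_h[of "W I"] min_supportD[OF W[OF that]]
      by linarith
  qed
  (* Saturating could add minimal exponents at Y v; the gap e together with g_ge excludes this. *)
  have vertex: "min_support \<Delta> g (Y v) = {v}" if v: "v \<in> ?V" for v
  proof (rule min_support_singletonI[OF \<Delta>])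
    show vZ: "v \<in> ?Z" using v VZ by blast
    fix J assume J: "J \<in> ?Z" "J \<noteq> v"
    have "Y v \<in> S" using v by (simp add: S_def)
    then have "trop_eval \<Delta> f (Y v) + e < f J + J \<bullet> Y v" using e(2) J Y[OF v] by blast
    moreover have "f v + v \<bullet> Y v = trop_eval \<Delta> f (Y v)" using Y[OF v] min_supportD by blast
    ultimately show "g v + v \<bullet> Y v < g J + J \<bullet> Y v"
      using g_ge[OF J(1)] gh[OF vZ] h_bounds(2)[of v] by linarith
  qed
  have "hypersurface \<Delta> g \<noteq> hypersurface \<Delta> f"
  proof
    assume "hypersurface \<Delta> g = hypersurface \<Delta> f"
    then obtain c where c: "\<And>y. trop_eval \<Delta> g y = trop_eval \<Delta> f y + c"
      using trop_eval_diff_const_if_hypersurface_eq[OF \<Delta>] Y vertex by metis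
    obtain v where v: "v \<in> ?V" "v \<notin> L" using L(3) by blast
    have "Y v \<in> S" using v by (simp add: S_def)
    then have "v \<in> min_support \<Delta> h (Y v)" using misses[of "Y v"] Y[OF v(1)] v(2) by simp
    then have "trop_eval \<Delta> h (Y v) = trop_eval \<Delta> f (Y v)"
      using min_supportD[of v \<Delta> h] min_supportD[of v \<Delta> f "Y v"] Y[OF v(1)] v(2) by (simp add: h_def)
    then have "c = 0" using c[of "Y v"] eval_g[OF \<open>Y v \<in> S\<close>] by simp
    obtain I where I: "I \<in> L" "I \<in> ?Z" using L by blast
    have "W I \<in> S" using I by (simp add: S_def)
    then have "trop_eval \<Delta> g (W I) \<le> trop_eval \<Delta> f (W I) - e"
      using eval_g[of "W I"] trop_eval_le[OF \<Delta> I(2), of h "W I"] min_supportD[OF W[OF I(2)]] I(1)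
      by (simp add: h_def)
    then show False using c[of "W I"] \<open>c = 0\<close> e(1) by simp
  qed
  moreover have "X \<subseteq> S" unfolding S_def by blast
  ultimately show ?thesis
    using meets misses supp_g by (intro that[OF g]) (meson order_trans subsetD)+
qed

theorem proposition3p3:
  fixes \<Delta> :: "(real ^ 'n) set"
    and f :: "real ^ 'n \<Rightarrow> real"
    and K :: nat
    and x :: "nat \<Rightarrow> real ^ 'n"
    and m :: "nat \<Rightarrow> nat"
  assumes "lattice_polytope \<Delta>"
    and "saturated \<Delta> f"
    and "\<And>i. i \<in> {1..K} \<Longrightarrow> x i \<in> hypersurface \<Delta> f"
    and "\<And>i. i \<in> {1..K} \<Longrightarrow> m i > 0"
    and "\<And>i. i \<in> {1..K} \<Longrightarrow> trop_mult \<Delta> f (x i) \<ge> m i"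
    and "\<And>i j P. \<lbrakk>i \<in> {1..K}; j \<in> {1..K}; i \<noteq> j; P \<in> dual_complex \<Delta> f\<rbrakk>
      \<Longrightarrow> \<not> (x i \<in> dual_rel_interior \<Delta> f P \<and> x j \<in> dual_rel_interior \<Delta> f P)"
  shows "(\<forall>g. saturated \<Delta> g \<and> (\<forall>i \<in> {1..K}. trop_mult \<Delta> g (x i) \<ge> m i)
            \<longrightarrow> hypersurface \<Delta> g = hypersurface \<Delta> f \<and>
                hypersurface_polyhedra \<Delta> g = hypersurface_polyhedra \<Delta> f)
         \<longleftrightarrow> rigid \<Delta> (dual_complex \<Delta> f) (point_weighting \<Delta> f K x m)"
proof -
  let ?\<mu> = "point_weighting \<Delta> f K x m" and ?Z = "lattice_points \<Delta>"
  note \<Delta> = assms(1) and f = assms(2)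
  have \<mu>_cell: "?\<mu> (convex hull min_support \<Delta> f (x i)) = int (m i)" if i: "i \<in> {1..K}" for i
  proof -
    let ?P = "convex hull min_support \<Delta> f (x i)"
    have P: "?P \<in> dual_complex \<Delta> f" unfolding dual_complex_def by blast
    have xi: "x i \<in> dual_rel_interior \<Delta> f ?P" unfolding dual_rel_interior_def by blast
    have "(THE j. j \<in> {1..K} \<and> x j \<in> dual_rel_interior \<Delta> f ?P) = i"
      by (rule the_equality) (use i xi assms(6)[OF _ i _ P] in blast)+
    then show ?thesis unfolding point_weighting_def using i xi by auto
  qed
  show ?thesis
  proof
    assume rigid: "rigid \<Delta> (dual_complex \<Delta> f) ?\<mu>"
    show "\<forall>g. saturated \<Delta> g \<and> (\<forall>i \<in> {1..K}. trop_mult \<Delta> g (x i) \<ge> m i)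
            \<longrightarrow> hypersurface \<Delta> g = hypersurface \<Delta> f \<and>
                hypersurface_polyhedra \<Delta> g = hypersurface_polyhedra \<Delta> f"
    proof (intro allI impI)
      fix g assume g: "saturated \<Delta> g \<and> (\<forall>i \<in> {1..K}. trop_mult \<Delta> g (x i) \<ge> m i)"
      define c where "c = Min ((\<lambda>I. g I - f I) ` ?Z)"
      have fin: "finite ((\<lambda>I. g I - f I) ` ?Z)" using lattice_polytope_finite[OF \<Delta>] by simp
      have ge: "f I + c \<le> g I" if "I \<in> ?Z" for I
        using Min_le[OF fin, of "g I - f I"] that by (simp add: c_def)
      have "c \<in> (\<lambda>I. g I - f I) ` ?Z"
        unfolding c_def using fin lattice_polytope_nonempty[OF \<Delta>] by (intro Min_in) auto
      then obtain J where J: "J \<in> ?Z" "g J = f J + c" by force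
      have const: "g I = f I + c" if I: "I \<in> ?Z" for I
      proof (rule ccontr)
        assume "g I \<noteq> f I + c"
        have "deformable \<Delta> (dual_complex \<Delta> f) ?\<mu> {I \<in> ?Z. g I = f I + c}"
        proof (rule deformable_argmin_diff[OF \<Delta> f _ ge J I \<open>g I \<noteq> f I + c\<close>])
          show "saturated \<Delta> g" using g by blast
          fix y assume pos: "?\<mu> (convex hull min_support \<Delta> f y) > 0"
          then obtain i where i: "i \<in> {1..K}"
              "convex hull min_support \<Delta> f (x i) = convex hull min_support \<Delta> f y"
            unfolding point_weighting_def dual_rel_interior_def by (auto split: if_splits)
          moreover have "?\<mu> (convex hull min_support \<Delta> f y) \<le> int (trop_mult \<Delta> g (x i))"
            using \<mu>_cell[OF i(1)] i(2) g i(1) by simp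
          ultimately show "\<exists>z. convex hull min_support \<Delta> f z = convex hull min_support \<Delta> f y \<and>
              ?\<mu> (convex hull min_support \<Delta> f y) \<le> int (trop_mult \<Delta> g z)" by blast
        qed
        then show False using rigid unfolding rigid_def by blast
      qed
      have "min_support \<Delta> g = min_support \<Delta> f"
        by (rule min_support_cong_add_const[OF const \<Delta>])
      then show "hypersurface \<Delta> g = hypersurface \<Delta> f \<and>
          hypersurface_polyhedra \<Delta> g = hypersurface_polyhedra \<Delta> f"
        by (simp add: hypersurface_def hypersurface_polyhedra_def dual_polyhedron_def
            dual_rel_interior_def dual_complex_def)
    qed
  next
    assume unique: "\<forall>g. saturated \<Delta> g \<and> (\<forall>i \<in> {1..K}. trop_mult \<Delta> g (x i) \<ge> m i)
            \<longrightarrow> hypersurface \<Delta> g = hypersurface \<Delta> f \<and>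
                hypersurface_polyhedra \<Delta> g = hypersurface_polyhedra \<Delta> f"
    show "rigid \<Delta> (dual_complex \<Delta> f) ?\<mu>"
      unfolding rigid_def
    proof
      assume "\<exists>L. deformable \<Delta> (dual_complex \<Delta> f) ?\<mu> L"
      then obtain L where L: "L \<noteq> {}" "L \<subseteq> ?Z" "\<not> cell_vertices (dual_complex \<Delta> f) \<subseteq> L"
        and count: "\<And>P. P \<in> dual_complex \<Delta> f \<Longrightarrow> card (P \<inter> L) = 0 \<or> int (card (P \<inter> L)) \<ge> ?\<mu> P + 1"
        unfolding deformable_def by blast
      obtain g where g: "saturated \<Delta> g" "hypersurface \<Delta> g \<noteq> hypersurface \<Delta> f"
        and misses: "\<And>y. \<lbrakk>y \<in> x ` {1..K}; min_support \<Delta> f y \<inter> L = {}\<rbrakk>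
          \<Longrightarrow> min_support \<Delta> f y \<subseteq> min_support \<Delta> g y"
        and meets: "\<And>y. y \<in> x ` {1..K} \<Longrightarrow> min_support \<Delta> f y \<inter> L \<subseteq> min_support \<Delta> g y"
        using exists_deformation[OF \<Delta> f _ L, of "x ` {1..K}"] by (metis finite_atLeastAtMost finite_imageI)
      have "trop_mult \<Delta> g (x i) \<ge> m i" if i: "i \<in> {1..K}" for i
      proof (cases "min_support \<Delta> f (x i) \<inter> L = {}")
        case True
        then have "card (min_support \<Delta> f (x i)) \<le> card (min_support \<Delta> g (x i))"
          using misses i finite_min_support[OF \<Delta>] by (intro card_mono) auto
        then show ?thesis using assms(5)[OF i] unfolding trop_mult_def by linarith
      next
        case False
        let ?P = "convex hull min_support \<Delta> f (x i)"
        have PL: "?P \<inter> L = min_support \<Delta> f (x i) \<inter> L" by (rule saturated_cell_Int[OF \<Delta> f L(2)])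
        have "card (?P \<inter> L) \<noteq> 0" using False PL finite_min_support[OF \<Delta>] by simp
        moreover have "?P \<in> dual_complex \<Delta> f" unfolding dual_complex_def by blast
        ultimately have "int (card (?P \<inter> L)) \<ge> int (m i) + 1" using count[of ?P] \<mu>_cell[OF i] by simp
        moreover have "card (?P \<inter> L) \<le> card (min_support \<Delta> g (x i))"
          unfolding PL using meets i finite_min_support[OF \<Delta>] by (intro card_mono) auto
        ultimately show ?thesis unfolding trop_mult_def by linarith
      qed
      then show False using unique g by blast
    qed
  qed
qed

end
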